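(* Let $(c_1,\dots,c_m)\in\mathbb{C}^m$ be a root of $-p_ic_i=f_i^A(c_1,\dots,c_m)$ $(i=1,\dots,m)$ with $c_j\neq 0$, and fix a branch of $c_j^{1/p_j}$. Then the eigenvalues of the Jacobi matrix of the vector field $$\frac{dX_i}{dt}=p_iX_i-p_j\frac{f_i+\varepsilon G_i}{f_j+\varepsilon G_j}\ (i\neq j),\qquad \frac{dZ}{dt}=rZ-\frac{p_j\varepsilon}{f_j+\varepsilon G_j},\qquad \frac{d\varepsilon}{dt}=s\varepsilon$$ at its fixed point $$X_i=c_ic_j^{-p_i/p_j}\ (i\ne j),\qquad Z=0,\qquad \varepsilon=0$$ are $r$, $s$ and the Kovalevskaya exponents associated with $(c_1,\dots,c_m)$ other than the trivial exponent $-1$ (counted with multiplicity, one copy of $-1$ being removed from the $m$ Kovalevskaya exponents). If one uses instead the polynomial vector field $$\frac{dX_i}{dt}=p_iX_i(f_j+\varepsilon G_j)-p_j(f_i+\varepsilon G_i)\ (i\ne j),\qquad \frac{dZ}{dt}=rZ(f_j+\varepsilon G_j)-p_j\varepsilon,\qquad \frac{d\varepsilon}{dt}=s\varepsilon(f_j+\varepsilon G_j),$$ the eigenvalues at this point change by a common constant factor.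
   Context: Consider the system $\frac{dx_i}{dz}=f_i(x_1,\dots,x_m,z)+g_i(x_1,\dots,x_m,z)$, $i=1,\dots,m$, with $f_i,g_i$ polynomials on $\mathbb{C}^{m+1}$, satisfying: (A1) there are positive integers $p_1,\dots,p_m,r$ with $f_i(\lambda^{p_1}x_1,\dots,\lambda^{p_m}x_m,\lambda^rz)=\lambda^{p_i+1}f_i(x_1,\dots,x_m,z)$ for all $\lambda\in\mathbb{C}$ and all $i$; (A2) $g_i(\lambda^{p_1}x_1,\dots,\lambda^{p_m}x_m,\lambda^rz)=o(\lambda^{p_i+1})$ as $|\lambda|\to\infty$; (A3) with $s=r+1$ and $\omega=e^{2\pi i/s}$, the system is invariant under $(x_1,\dots,x_m,z)\mapsto(\omega^{p_1}x_1,\dots,\omega^{p_m}x_m,\omega^rz)$. Put $f_i^A(x_1,\dots,x_m):=f_i(x_1,\dots,x_m,0)$. For a root $(c_1,\dots,c_m)$ of $-p_ic_i=f_i^A(c_1,\dots,c_m)$ $(i=1,\dots,m)$, the Kovalevskaya matrix is $K=\left(\frac{\partial f_i^A}{\partial x_l}(c_1,\dots,c_m)+p_i\delta_{il}\right)_{i,l=1}^m$, and its eigenvalues are the Kovalevskaya exponents associated with the root. $-1$ is always an eigenvalue of $K$ when the root is nonzero, with eigenvector $(-p_1c_1,\dots,-p_mc_m)^T$. The $j$-th inhomogeneous coordinates $(X_1,\dots,X_{j-1},X_{j+1},\dots,X_m,Z,\varepsilon)$ of the weighted projective space $\mathbb{C}P^{m+1}(p_1,\dots,p_m,r,s)$ are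 given by $x_i=X_i\varepsilon^{-p_i/s}$ $(i\ne j)$, $x_j=\varepsilon^{-p_j/s}$, $z=Z\varepsilon^{-r/s}$. In the vector fields, $f_i$ means $f_i(X_1,\dots,X_{j-1},1,X_{j+1},\dots,X_m,Z)$ (the value $1$ in the $j$-th slot), and $G_i$ is the polynomial in $(X_1,\dots,X_{j-1},X_{j+1},\dots,X_m,Z,\varepsilon)$ determined by $$g_i(X_1\varepsilon^{-p_1/s},\dots,\varepsilon^{-p_j/s},\dots,X_m\varepsilon^{-p_m/s},Z\varepsilon^{-r/s})=\varepsilon^{1-(1+p_i)/s}\,G_i.$$ All powers $c_j^{-p_i/p_j}$ are taken with the fixed branch of $c_j^{1/p_j}$. *)

theory Defs
  imports "HOL-Analysis.Analysis" "HOL-Library.Landau_Symbols" "Jordan_Normal_Form.Char_Poly"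
begin

text \<open>
  Points of \<open>\<complex>\<^sup>n\<close> are functions \<open>nat \<Rightarrow> complex\<close> of which only the entries below \<open>n\<close> matter.
  The functions \<open>f i\<close>, \<open>g i\<close> (\<open>i < m\<close>) live on \<open>\<complex>\<^sup>m\<^sup>+\<^sup>1\<close>, a point \<open>(x, z)\<close> being
  \<open>x(m := z)\<close>: entries \<open>0..m-1\<close> hold \<open>x\<close>, entry \<open>m\<close> holds \<open>z\<close>.
\<close>

definition polynomial_in :: "nat \<Rightarrow> ((nat \<Rightarrow> complex) \<Rightarrow> complex) \<Rightarrow> bool" where
  "polynomial_in n F \<longleftrightarrow>
     (\<exists>(S :: (nat \<Rightarrow> nat) set) a. finite S \<and>
        (\<forall>y. F y = (\<Sum>\<alpha>\<in>S. a \<alpha> * (\<Prod>k<n. y k ^ \<alpha> k))))"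

definition weights :: "nat \<Rightarrow> (nat \<Rightarrow> nat) \<Rightarrow> nat \<Rightarrow> nat \<Rightarrow> nat" where
  "weights m p r = p(m := r)"

definition wscale :: "(nat \<Rightarrow> nat) \<Rightarrow> complex \<Rightarrow> (nat \<Rightarrow> complex) \<Rightarrow> nat \<Rightarrow> complex" where
  "wscale w a y = (\<lambda>k. a ^ w k * y k)"

text \<open>
  Substituting \<open>(\<omega> ^ p i * x i, \<omega> ^ r * z)\<close> for \<open>(x i, z)\<close> turns \<open>dx i / dz = F i (x, z)\<close> into
  \<open>(\<omega> ^ p i / \<omega> ^ r) * dx i / dz = F i (scaled point)\<close>; the system is invariant when this is
  again the original system.
\<close>

definition system_invariant ::
  "nat \<Rightarrow> (nat \<Rightarrow> nat) \<Rightarrow> nat \<Rightarrow> (nat \<Rightarrow> (nat \<Rightarrow> complex) \<Rightarrow> complex) \<Rightarrow> complex \<Rightarrow> bool" where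
  "system_invariant m p r F \<omega> \<longleftrightarrow>
     (\<forall>i<m. \<forall>y. F i (wscale (weights m p r) \<omega> y) = (\<omega> ^ p i / \<omega> ^ r) * F i y)"

definition partial_deriv :: "nat \<Rightarrow> ((nat \<Rightarrow> complex) \<Rightarrow> complex) \<Rightarrow> (nat \<Rightarrow> complex) \<Rightarrow> complex" where
  "partial_deriv l F y = deriv (\<lambda>t. F (y(l := t))) (y l)"

definition jacobi_matrix ::
  "nat \<Rightarrow> ((nat \<Rightarrow> complex) \<Rightarrow> nat \<Rightarrow> complex) \<Rightarrow> (nat \<Rightarrow> complex) \<Rightarrow> complex mat" where
  "jacobi_matrix n V y = Matrix.mat n n (\<lambda>(k, l). partial_deriv l (\<lambda>u. V u k) y)"

text \<open>Eigenvalues with algebraic multiplicity.\<close>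

definition eigenvalue_mset :: "complex mat \<Rightarrow> complex multiset" where
  "eigenvalue_mset A = proots (char_poly A)"

definition autonomous_part ::
  "nat \<Rightarrow> (nat \<Rightarrow> (nat \<Rightarrow> complex) \<Rightarrow> complex) \<Rightarrow> nat \<Rightarrow> (nat \<Rightarrow> complex) \<Rightarrow> complex" where
  "autonomous_part m f i x = f i (x(m := 0))"

definition kovalevskaya_matrix ::
  "nat \<Rightarrow> (nat \<Rightarrow> nat) \<Rightarrow> (nat \<Rightarrow> (nat \<Rightarrow> complex) \<Rightarrow> complex) \<Rightarrow> (nat \<Rightarrow> complex) \<Rightarrow> complex mat" where
  "kovalevskaya_matrix m p f c = Matrix.mat m m (\<lambda>(i, l).
     partial_deriv l (autonomous_part m f i) c + (if i = l then of_nat (p i) else 0))"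

definition kovalevskaya_exponents ::
  "nat \<Rightarrow> (nat \<Rightarrow> nat) \<Rightarrow> (nat \<Rightarrow> (nat \<Rightarrow> complex) \<Rightarrow> complex) \<Rightarrow> (nat \<Rightarrow> complex) \<Rightarrow> complex multiset" where
  "kovalevskaya_exponents m p f c = eigenvalue_mset (kovalevskaya_matrix m p f c)"

text \<open>
  A point \<open>Y\<close> of the \<open>j\<close>-th inhomogeneous chart, again in \<open>\<complex>\<^sup>m\<^sup>+\<^sup>1\<close>, lists
  \<open>(X\<^sub>0, \<dots>, X\<^sub>j\<^sub>-\<^sub>1, X\<^sub>j\<^sub>+\<^sub>1, \<dots>, X\<^sub>m\<^sub>-\<^sub>1, Z, \<epsilon>)\<close>: \<open>X\<^sub>i\<close> (\<open>i \<noteq> j\<close>) is entry \<open>delete_index j i\<close>,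
  \<open>Z\<close> is entry \<open>m - 1 = delete_index j m\<close> and \<open>\<epsilon>\<close> is entry \<open>m\<close>. Conversely entry \<open>k < m - 1\<close> is
  \<open>X\<^sub>i\<close> with \<open>i = insert_index j k\<close>.

  \<open>chart_slice j Y\<close> is the argument \<open>(X\<^sub>0, \<dots>, X\<^sub>j\<^sub>-\<^sub>1, 1, X\<^sub>j\<^sub>+\<^sub>1, \<dots>, X\<^sub>m\<^sub>-\<^sub>1, Z)\<close> of \<open>f i\<close>
  (its entries above \<open>m\<close> are irrelevant).
\<close>

definition chart_slice :: "nat \<Rightarrow> (nat \<Rightarrow> complex) \<Rightarrow> nat \<Rightarrow> complex" where
  "chart_slice j Y = (\<lambda>k. if k = j then 1 else Y (delete_index j k))"

text \<open>
  The identity \<open>g\<^sub>i(x, z) = \<epsilon>\<^bsup>1-(1+p i)/s\<^esup> G\<^sub>i\<close> at \<open>x\<^sub>k = X\<^sub>k \<epsilon>\<^bsup>-p k/s\<^esup>\<close>, \<open>x\<^sub>j = \<epsilon>\<^bsup>-p j/s\<^esup>\<close>, \<open>z = Z \<epsilon>\<^bsup>-r/s\<^esup>\<close>,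
  where \<open>s = r + 1\<close> and \<open>\<eta>\<close> stands for \<open>\<epsilon>\<^bsup>1/s\<^esup>\<close> and ranges over all branches. Under the standing
  assumptions on \<open>g\<close> there is exactly one such polynomial function \<open>G\<close>.
\<close>

definition is_chart_remainder ::
  "nat \<Rightarrow> (nat \<Rightarrow> nat) \<Rightarrow> nat \<Rightarrow> (nat \<Rightarrow> (nat \<Rightarrow> complex) \<Rightarrow> complex) \<Rightarrow> nat \<Rightarrow> nat
     \<Rightarrow> ((nat \<Rightarrow> complex) \<Rightarrow> complex) \<Rightarrow> bool" where
  "is_chart_remainder m p r g j i G \<longleftrightarrow>
     polynomial_in (m + 1) G \<and>
     (\<forall>Y \<eta>. \<eta> \<noteq> 0 \<longrightarrow> Y m = \<eta> ^ (r + 1) \<longrightarrow>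
        g i (wscale (weights m p r) (inverse \<eta>) (chart_slice j Y))
          = \<eta> powi (int (r + 1) - (1 + int (p i))) * G Y)"

definition chart_remainder ::
  "nat \<Rightarrow> (nat \<Rightarrow> nat) \<Rightarrow> nat \<Rightarrow> (nat \<Rightarrow> (nat \<Rightarrow> complex) \<Rightarrow> complex) \<Rightarrow> nat \<Rightarrow> nat
     \<Rightarrow> (nat \<Rightarrow> complex) \<Rightarrow> complex" where
  "chart_remainder m p r g j i = (THE G. is_chart_remainder m p r g j i G)"

text \<open>\<open>f\<^sub>i + \<epsilon> G\<^sub>i\<close> in the \<open>j\<close>-th chart.\<close>

definition chart_rhs ::
  "nat \<Rightarrow> (nat \<Rightarrow> nat) \<Rightarrow> nat \<Rightarrow> (nat \<Rightarrow> (nat \<Rightarrow> complex) \<Rightarrow> complex)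
     \<Rightarrow> (nat \<Rightarrow> (nat \<Rightarrow> complex) \<Rightarrow> complex) \<Rightarrow> nat \<Rightarrow> nat \<Rightarrow> (nat \<Rightarrow> complex) \<Rightarrow> complex" where
  "chart_rhs m p r f g j i Y = f i (chart_slice j Y) + Y m * chart_remainder m p r g j i Y"

definition rational_field ::
  "nat \<Rightarrow> (nat \<Rightarrow> nat) \<Rightarrow> nat \<Rightarrow> (nat \<Rightarrow> (nat \<Rightarrow> complex) \<Rightarrow> complex)
     \<Rightarrow> (nat \<Rightarrow> (nat \<Rightarrow> complex) \<Rightarrow> complex) \<Rightarrow> nat \<Rightarrow> (nat \<Rightarrow> complex) \<Rightarrow> nat \<Rightarrow> complex" where
  "rational_field m p r f g j Y k =
     (if k < m - 1 then
        of_nat (p (insert_index j k)) * Y k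
          - of_nat (p j) * (chart_rhs m p r f g j (insert_index j k) Y / chart_rhs m p r f g j j Y)
      else if k = m - 1 then
        of_nat r * Y k - of_nat (p j) * Y m / chart_rhs m p r f g j j Y
      else of_nat (r + 1) * Y m)"

definition polynomial_field ::
  "nat \<Rightarrow> (nat \<Rightarrow> nat) \<Rightarrow> nat \<Rightarrow> (nat \<Rightarrow> (nat \<Rightarrow> complex) \<Rightarrow> complex)
     \<Rightarrow> (nat \<Rightarrow> (nat \<Rightarrow> complex) \<Rightarrow> complex) \<Rightarrow> nat \<Rightarrow> (nat \<Rightarrow> complex) \<Rightarrow> nat \<Rightarrow> complex" where
  "polynomial_field m p r f g j Y k =
     (if k < m - 1 then
        of_nat (p (insert_index j k)) * Y k * chart_rhs m p r f g j j Y
          - of_nat (p j) * chart_rhs m p r f g j (insert_index j k) Y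
      else if k = m - 1 then
        of_nat r * Y k * chart_rhs m p r f g j j Y - of_nat (p j) * Y m
      else of_nat (r + 1) * Y m * chart_rhs m p r f g j j Y)"

text \<open>
  The point \<open>X\<^sub>i = c\<^sub>i c\<^sub>j\<^bsup>-p i/p j\<^esup>\<close>, \<open>Z = \<epsilon> = 0\<close>; the argument \<open>b\<close> is the chosen value of
  \<open>c\<^sub>j\<^bsup>1/p j\<^esup>\<close>, i.e. \<open>b ^ p j = c j\<close>.
\<close>

definition root_point ::
  "nat \<Rightarrow> (nat \<Rightarrow> nat) \<Rightarrow> nat \<Rightarrow> (nat \<Rightarrow> complex) \<Rightarrow> complex \<Rightarrow> nat \<Rightarrow> complex" where
  "root_point m p j c b k =
     (if k < m - 1 then c (insert_index j k) * b powi (- int (p (insert_index j k))) else 0)"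

end

theory Submission
  imports Defs "Jordan_Normal_Form.Jordan_Normal_Form_Existence"
begin

text \<open>
  At the fixed point the last two rows of the Jacobi matrix, those of \<open>Z\<close> and \<open>\<epsilon>\<close>, vanish to the
  left of the diagonal entries \<open>r\<close> and \<open>s\<close>, so only the \<open>X\<close>-block matters. By weighted
  homogeneity of the partial derivatives of \<open>f\<close>, this block is conjugate, under the diagonal matrix
  of the \<open>c\<^sub>j\<^bsup>-p i/p j\<^esup>\<close>, to \<open>(K\<^sub>i\<^sub>l - v\<^sub>i/v\<^sub>j K\<^sub>j\<^sub>l)\<close> (\<open>i, l \<noteq> j\<close>) with \<open>v\<^sub>i = p\<^sub>i c\<^sub>i\<close>. Euler's identity gives
  \<open>K v = - v\<close>, and the matrix above describes the action of \<open>K\<close> on the quotient by the line of \<open>v\<close>,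
  so that its characteristic polynomial is that of \<open>K\<close> with one factor \<open>x + 1\<close> removed.
  The polynomial field is the rational one times \<open>f\<^sub>j + \<epsilon> G\<^sub>j\<close>, whose value at the fixed point is the
  constant factor.
\<close>

section \<open>Characteristic polynomials\<close>

text \<open>Laplace expansion of the characteristic matrix along column \<open>i\<close> leaves one
  cofactor, and deleting row and column \<open>i\<close> commutes with forming the characteristic
  matrix.\<close>

lemma char_poly_column_unit:
  fixes A :: "'a :: comm_ring_1 mat"
  assumes A: "A \<in> carrier_mat n n" and i: "i < n"
    and zero: "\<And>k. k < n \<Longrightarrow> k \<noteq> i \<Longrightarrow> A $$ (k, i) = 0"
  shows "char_poly A = [:- (A $$ (i, i)), 1:] * char_poly (mat_delete A i i)"
proof -
  let ?C = "char_poly_matrix A"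
  have C: "?C \<in> carrier_mat n n" using A by simp
  have "char_poly A = (\<Sum>k<n. ?C $$ (k, i) * cofactor ?C k i)"
    unfolding char_poly_def by (rule laplace_expansion_column[OF C i])
  also have "\<dots> = (\<Sum>k<n. if k = i then ?C $$ (i, i) * cofactor ?C i i else 0)"
    using A i zero by (intro sum.cong) (auto simp: char_poly_matrix_def)
  also have "\<dots> = ?C $$ (i, i) * cofactor ?C i i"
    using i by simp
  also have "?C $$ (i, i) = [:- (A $$ (i, i)), 1:]"
    using A i by (auto simp: char_poly_matrix_def)
  also have "cofactor ?C i i = char_poly (mat_delete A i i)"
  proof -
    have "mat_delete ?C i i = char_poly_matrix (mat_delete A i i)"
      using A i by (intro eq_matI) (auto simp: mat_delete_def char_poly_matrix_def)
    then show ?thesis by (simp add: cofactor_def char_poly_def)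
  qed
  finally show ?thesis .
qed

lemma char_poly_row_unit:
  fixes A :: "'a :: comm_ring_1 mat"
  assumes A: "A \<in> carrier_mat n n" and i: "i < n"
    and zero: "\<And>k. k < n \<Longrightarrow> k \<noteq> i \<Longrightarrow> A $$ (i, k) = 0"
  shows "char_poly A = [:- (A $$ (i, i)), 1:] * char_poly (mat_delete A i i)"
proof -
  have "char_poly A = char_poly (transpose_mat A)"
    using A by simp
  also have "\<dots> = [:- (transpose_mat A $$ (i, i)), 1:] * char_poly (mat_delete (transpose_mat A) i i)"
    using A i zero by (intro char_poly_column_unit) auto
  also have "mat_delete (transpose_mat A) i i = transpose_mat (mat_delete A i i)"
    using A i by (intro eq_matI) (auto simp: mat_delete_def)
  finally show ?thesis
    using A i mat_delete_carrier[OF A, of i i] by simp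
qed

lemma char_poly_two_last_rows:
  fixes A :: "'a :: comm_ring_1 mat"
  assumes A: "A \<in> carrier_mat (Suc (Suc n)) (Suc (Suc n))"
    and zero1: "\<And>k. k < Suc n \<Longrightarrow> A $$ (Suc n, k) = 0"
    and zero2: "\<And>k. k < n \<Longrightarrow> A $$ (n, k) = 0"
  shows "char_poly A = [:- (A $$ (Suc n, Suc n)), 1:] * ([:- (A $$ (n, n)), 1:] *
    char_poly (Matrix.mat n n (\<lambda>(k, l). A $$ (k, l))))"
proof -
  let ?B = "mat_delete A (Suc n) (Suc n)"
  have B: "?B \<in> carrier_mat (Suc n) (Suc n)"
    using mat_delete_carrier[OF A] by simp
  have B_index: "?B $$ (k, l) = A $$ (k, l)" if "k < Suc n" "l < Suc n" for k l
    using that A by (auto simp: mat_delete_def)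
  have "char_poly A = [:- (A $$ (Suc n, Suc n)), 1:] * char_poly ?B"
    using zero1 by (intro char_poly_row_unit[OF A]) auto
  also have "char_poly ?B = [:- (?B $$ (n, n)), 1:] * char_poly (mat_delete ?B n n)"
    using zero2 by (intro char_poly_row_unit[OF B]) (auto simp: B_index)
  also have "mat_delete ?B n n = Matrix.mat n n (\<lambda>(k, l). A $$ (k, l))"
    using A by (intro eq_matI) (auto simp: mat_delete_def)
  finally show ?thesis by (simp add: B_index)
qed

text \<open>The matrix on the left is \<open>P * A * Q\<close> with \<open>P\<close> the diagonal
  matrix of the \<open>d k\<close> and \<open>Q\<close> its inverse, hence similar to
  \<open>A\<close>.\<close>

lemma char_poly_diagonal_conjugate:
  fixes A :: "'a :: field mat"
  assumes A: "A \<in> carrier_mat n n" and d: "\<And>k. k < n \<Longrightarrow> d k \<noteq> 0"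
  shows "char_poly (Matrix.mat n n (\<lambda>(k, l). d k / d l * A $$ (k, l))) = char_poly A"
proof -
  define P where "P = Matrix.mat n n (\<lambda>(k, l). if k = l then d k else 0)"
  define Q where "Q = Matrix.mat n n (\<lambda>(k, l). if k = l then inverse (d k) else 0)"
  have [simp]: "P \<in> carrier_mat n n" "Q \<in> carrier_mat n n"
    "dim_row P = n" "dim_col P = n" "dim_row Q = n" "dim_col Q = n"
    by (auto simp: P_def Q_def)
  have row: "(P * X) $$ (k, l) = d k * X $$ (k, l)"
    if "X \<in> carrier_mat n n" "k < n" "l < n" for X k l
    using that
    by (auto simp: P_def scalar_prod_def if_distrib[of "\<lambda>x. x * _"] sum.delta cong: if_cong)
  have col: "(X * Q) $$ (k, l) = X $$ (k, l) / d l"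
    if "X \<in> carrier_mat n n" "k < n" "l < n" for X k l
    using that
    by (auto simp: Q_def scalar_prod_def if_distrib[of "\<lambda>x. _ * x"] sum.delta divide_inverse
        cong: if_cong)
  have "P * Q = 1\<^sub>m n"
    using d by (intro eq_matI) (auto simp: row simp del: index_mult_mat(1), auto simp: Q_def)
  moreover have "Q * P = 1\<^sub>m n"
    using calculation by (rule mat_mult_left_right_inverse[rotated 2]) auto
  moreover have "Matrix.mat n n (\<lambda>(k, l). d k / d l * A $$ (k, l)) = P * A * Q"
  proof (rule eq_matI, goal_cases)
    case (1 k l)
    have "P * A \<in> carrier_mat n n"
      using A by (rule mult_carrier_mat[rotated]) simp
    with 1 A show ?case by (simp add: row col del: index_mult_mat(1))
  qed auto
  ultimately have "similar_mat (Matrix.mat n n (\<lambda>(k, l). d k / d l * A $$ (k, l))) A"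
    using A by (intro similar_matI[of _ A P Q n]) auto
  then show ?thesis by (rule char_poly_similar)
qed

text \<open>The matrix \<open>Q\<close> exchanges the \<open>j\<close>-th basis vector for
  \<open>v\<close> divided by \<open>v j\<close>, and \<open>P\<close> is its inverse. In this basis
  column \<open>j\<close> is \<open>\<mu>\<close> times a unit vector; the remaining block is the
  action of \<open>A\<close> on the quotient by the line of \<open>v\<close>.\<close>

lemma char_poly_deflate:
  fixes A :: "'a :: field mat"
  assumes A: "A \<in> carrier_mat n n" and j: "j < n" "v j \<noteq> 0"
    and eig: "\<And>i. i < n \<Longrightarrow> (\<Sum>l<n. A $$ (i, l) * v l) = \<mu> * v i"
  shows "char_poly A = [:- \<mu>, 1:] * char_poly (Matrix.mat (n - 1) (n - 1) (\<lambda>(k, l).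
    A $$ (insert_index j k, insert_index j l)
      - v (insert_index j k) / v j * A $$ (j, insert_index j l)))"
    (is "_ = _ * char_poly ?N")
proof -
  define w where "w i = (if i = j then 0 else v i / v j)" for i
  define P where "P = Matrix.mat n n (\<lambda>(i, l). (if l = i then 1 else 0) - (if l = j then w i else 0))"
  define Q where "Q = Matrix.mat n n (\<lambda>(i, l). (if i = l then 1 else 0) + (if l = j then w i else 0))"
  have [simp]: "P \<in> carrier_mat n n" "Q \<in> carrier_mat n n"
    "dim_row P = n" "dim_col P = n" "dim_row Q = n" "dim_col Q = n"
    by (auto simp: P_def Q_def)
  have row: "(P * X) $$ (i, l) = X $$ (i, l) - w i * X $$ (j, l)"
    if "X \<in> carrier_mat n n" "i < n" "l < n" for X i l
  proof -
    have "(P * X) $$ (i, l) = (\<Sum>k = 0..<n. (if k = i then X $$ (k, l) else 0)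
        - (if k = j then w i * X $$ (k, l) else 0))"
      using that by (auto simp: P_def scalar_prod_def algebra_simps intro!: sum.cong)
    then show ?thesis using that j by (simp add: sum_subtractf)
  qed
  have col: "(X * Q) $$ (i, l) = (if l = j then (\<Sum>k<n. X $$ (i, k) * v k) / v j else X $$ (i, l))"
    if "X \<in> carrier_mat n n" "i < n" "l < n" for X i l
  proof -
    have "(X * Q) $$ (i, l) = (\<Sum>k = 0..<n. if l = j then X $$ (i, k) * v k / v j
        else if k = l then X $$ (i, k) else 0)"
      using that j by (auto simp: Q_def scalar_prod_def w_def intro!: sum.cong)
    then show ?thesis using that j
      by (auto simp: lessThan_atLeast0 sum_divide_distrib)
  qed
  have PQ: "P * Q = 1\<^sub>m n"
    using j by (intro eq_matI) (auto simp: row simp del: index_mult_mat(1), auto simp: Q_def w_def)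
  have QP: "Q * P = 1\<^sub>m n"
    using PQ by (rule mat_mult_left_right_inverse[rotated 2]) auto
  define B where "B = P * (A * Q)"
  have AQ: "A * Q \<in> carrier_mat n n" using A by simp
  have B: "B \<in> carrier_mat n n"
    unfolding B_def using AQ by (rule mult_carrier_mat[rotated]) simp
  have B_index: "B $$ (i, l) = (if l = j then (if i = j then \<mu> else 0)
      else A $$ (i, l) - w i * A $$ (j, l))" if "i < n" "l < n" for i l
    using that A AQ j by (simp add: B_def row col eig w_def del: index_mult_mat(1))
  have "similar_mat B A"
    using A PQ QP by (intro similar_matI[of _ A P Q n]) (auto simp: B_def assoc_mult_mat[of P n n A n Q n])
  then have "char_poly A = char_poly B"
    by (simp add: char_poly_similar)
  also have "\<dots> = [:- (B $$ (j, j)), 1:] * char_poly (mat_delete B j j)"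
    using B j by (intro char_poly_column_unit) (auto simp: B_index)
  also have "mat_delete B j j = ?N"
  proof (rule eq_matI, goal_cases)
    case (1 k l)
    then have k: "k < n - 1" "l < n - 1" by auto
    then have "B $$ (insert_index j k, insert_index j l) = mat_delete B j j $$ (k, l)"
      using B j by (intro mat_delete_index[of B "n - 1"]) auto
    moreover have "insert_index j k < n" "insert_index j l < n"
      using k by (auto simp: insert_index_def)
    ultimately show ?case
      using k by (auto simp: B_index w_def)
  qed (use B in auto)
  finally show ?thesis using j by (simp add: B_index)
qed

text \<open>The order of a root \<open>x\<close> of the scaled characteristic polynomial is the
  order of \<open>x / \<kappa>\<close> for the original one, so multiplicities are carried
  along.\<close>

lemma eigenvalue_mset_smult:
  assumes A: "A \<in> carrier_mat n n" and \<kappa>: "\<kappa> \<noteq> 0"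
  shows "eigenvalue_mset (\<kappa> \<cdot>\<^sub>m A) = image_mset (\<lambda>\<mu>. \<kappa> * \<mu>) (eigenvalue_mset A)"
proof (rule multiset_eqI)
  fix x
  have "char_poly A \<noteq> 0" "char_poly (\<kappa> \<cdot>\<^sub>m A) \<noteq> 0"
    using degree_monic_char_poly[OF A] degree_monic_char_poly[of "\<kappa> \<cdot>\<^sub>m A" n] A by auto
  moreover have "count (image_mset (\<lambda>\<mu>. \<kappa> * \<mu>) M) x = count M (x / \<kappa>)" for M :: "complex multiset"
    using \<kappa> by (induction M) auto
  ultimately show "count (eigenvalue_mset (\<kappa> \<cdot>\<^sub>m A)) x
      = count (image_mset (\<lambda>\<mu>. \<kappa> * \<mu>) (eigenvalue_mset A)) x"
    by (simp add: eigenvalue_mset_def order_char_poly_smult[OF A \<kappa>])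
qed

section \<open>Polynomial functions and weighted homogeneity\<close>

text \<open>Serves sums whose exponent vectors \<open>e i\<close> may coincide for different
  \<open>i\<close>: \<open>polynomial_in\<close> indexes its sum by the exponent vectors themselves,
  so such terms are merged.\<close>

lemma polynomial_in_sum_monomials:
  fixes e :: "'i \<Rightarrow> nat \<Rightarrow> nat"
  assumes I: "finite I" and F: "\<And>y. F y = (\<Sum>i\<in>I. a i * (\<Prod>k<n. y k ^ e i k))"
  shows "polynomial_in n F"
proof -
  have "F y = (\<Sum>\<alpha>\<in>e ` I. (\<Sum>i | i \<in> I \<and> e i = \<alpha>. a i) * (\<Prod>k<n. y k ^ \<alpha> k))" for y
    unfolding F by (subst sum.image_gen[OF I, of _ e]) (auto simp: sum_distrib_right intro!: sum.cong)
  then show ?thesis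
    unfolding polynomial_in_def
    by (intro exI[of _ "e ` I"] exI[of _ "\<lambda>\<alpha>. \<Sum>i | i \<in> I \<and> e i = \<alpha>. a i"])
      (simp add: I)
qed

text \<open>Points are total functions, and the points compared later are known to agree only on
  their first \<open>n\<close> entries.\<close>

lemma polynomial_in_cong:
  assumes "polynomial_in n F" and "\<And>k. k < n \<Longrightarrow> y k = y' k"
  shows "F y = F y'"
proof -
  obtain S a where F: "\<And>y. F y = (\<Sum>\<alpha>\<in>S. a \<alpha> * (\<Prod>k<n. y k ^ \<alpha> k))"
    using assms(1) unfolding polynomial_in_def by blast
  show ?thesis
    unfolding F using assms(2) by (intro sum.cong prod.cong arg_cong2[of _ _ _ _ "(*)"]) auto
qed

lemma partial_deriv_cong:
  assumes "polynomial_in n F" and "\<And>k. k < n \<Longrightarrow> y k = y' k" and "l < n"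
  shows "partial_deriv l F y = partial_deriv l F y'"
proof -
  have "(\<lambda>t. F (y(l := t))) = (\<lambda>t. F (y'(l := t)))"
    using assms(2) by (intro ext polynomial_in_cong[OF assms(1)]) auto
  then show ?thesis
    using assms(2,3) by (simp add: partial_deriv_def)
qed

text \<open>The product rule on each monomial yields a gradient \<open>D\<close> that does not
  depend on the curve \<open>u\<close>, so that it can be evaluated along coordinate lines and along
  weighted dilations alike.\<close>

lemma polynomial_in_DERIV_explicit:
  assumes "polynomial_in n F"
  obtains D where "\<And>u u' x. (\<And>k. k < n \<Longrightarrow> ((\<lambda>t. u t k) has_field_derivative u' k) (at x)) \<Longrightarrow>
    ((\<lambda>t. F (u t)) has_field_derivative (\<Sum>k<n. D k (u x) * u' k)) (at x)"
proof -
  obtain S a where F: "\<And>y. F y = (\<Sum>\<alpha>\<in>S. a \<alpha> * (\<Prod>k<n. y k ^ \<alpha> k))"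
    using assms(1) unfolding polynomial_in_def by blast
  define D where "D k y = (\<Sum>\<alpha>\<in>S. a \<alpha> * (of_nat (\<alpha> k) * y k ^ (\<alpha> k - 1) *
    (\<Prod>l\<in>{..<n} - {k}. y l ^ \<alpha> l)))" for k and y :: "nat \<Rightarrow> complex"
  show thesis
  proof (rule that[of D])
    fix u :: "complex \<Rightarrow> nat \<Rightarrow> complex" and u' x
    assume u: "\<And>k. k < n \<Longrightarrow> ((\<lambda>t. u t k) has_field_derivative u' k) (at x)"
    have mono: "((\<lambda>t. \<Prod>k<n. u t k ^ \<alpha> k) has_field_derivative
        (\<Sum>k<n. (of_nat (\<alpha> k) * u x k ^ (\<alpha> k - 1) * u' k) * (\<Prod>l\<in>{..<n} - {k}. u x l ^ \<alpha> l))) (at x)"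
      for \<alpha>
      by (rule has_field_derivative_prod, rule DERIV_cong[OF DERIV_power[OF u]]) auto
    have "((\<lambda>t. F (u t)) has_field_derivative
        (\<Sum>\<alpha>\<in>S. a \<alpha> * (\<Sum>k<n. (of_nat (\<alpha> k) * u x k ^ (\<alpha> k - 1) * u' k) *
          (\<Prod>l\<in>{..<n} - {k}. u x l ^ \<alpha> l)))) (at x)"
      unfolding F by (intro DERIV_sum DERIV_cmult mono)
    also have "(\<Sum>\<alpha>\<in>S. a \<alpha> * (\<Sum>k<n. (of_nat (\<alpha> k) * u x k ^ (\<alpha> k - 1) * u' k) *
          (\<Prod>l\<in>{..<n} - {k}. u x l ^ \<alpha> l))) = (\<Sum>k<n. D k (u x) * u' k)"
      unfolding D_def sum_distrib_left sum_distrib_right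
      by (subst sum.swap) (simp add: mult_ac)
    finally show "((\<lambda>t. F (u t)) has_field_derivative (\<Sum>k<n. D k (u x) * u' k)) (at x)" .
  qed
qed

lemma polynomial_in_DERIV_coordinate:
  assumes F: "polynomial_in n F" and l: "l < n"
  shows "((\<lambda>t. F (y(l := t))) has_field_derivative partial_deriv l F y) (at (y l))"
proof -
  obtain D where D: "\<And>u u' x. (\<And>k. k < n \<Longrightarrow> ((\<lambda>t. u t k) has_field_derivative u' k) (at x)) \<Longrightarrow>
    ((\<lambda>t. F (u t)) has_field_derivative (\<Sum>k<n. D k (u x) * u' k)) (at x)"
    using polynomial_in_DERIV_explicit[OF F] by blast
  have "((\<lambda>t. F (y(l := t))) has_field_derivative
      (\<Sum>k<n. D k (y(l := y l)) * (if k = l then 1 else 0))) (at (y l))"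
    by (rule D) auto
  then show ?thesis
    unfolding partial_deriv_def by (simp only: DERIV_imp_deriv)
qed

lemma polynomial_in_DERIV_chain:
  assumes F: "polynomial_in n F"
    and u: "\<And>k. k < n \<Longrightarrow> ((\<lambda>t. u t k) has_field_derivative u' k) (at x)"
  shows "((\<lambda>t. F (u t)) has_field_derivative (\<Sum>k<n. partial_deriv k F (u x) * u' k)) (at x)"
proof -
  obtain D where D: "\<And>u u' x. (\<And>k. k < n \<Longrightarrow> ((\<lambda>t. u t k) has_field_derivative u' k) (at x)) \<Longrightarrow>
    ((\<lambda>t. F (u t)) has_field_derivative (\<Sum>k<n. D k (u x) * u' k)) (at x)"
    using polynomial_in_DERIV_explicit[OF F] by blast
  \<comment> \<open>Along the coordinate line through \<open>y\<close> the chain rule identifies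
    \<open>D\<close> with the partial derivatives.\<close>
  have "partial_deriv l F y = D l y" if l: "l < n" for l y
  proof -
    have "((\<lambda>t. F (y(l := t))) has_field_derivative
        (\<Sum>k<n. D k (y(l := y l)) * (if k = l then 1 else 0))) (at (y l))"
      by (rule D) auto
    then show ?thesis
      using l by (auto simp: partial_deriv_def if_distrib cong: if_cong dest: DERIV_imp_deriv)
  qed
  then show ?thesis
    using D[of u u' x, OF u] by simp
qed

text \<open>Both sides of the homogeneity identity are differentiated in coordinate
  \<open>l\<close>; the inner scaling contributes the factor \<open>a ^ w l\<close>.\<close>

lemma weighted_homogeneous_partial_deriv:
  assumes F: "polynomial_in n F"
    and hom: "\<And>y. F (wscale w a y) = a ^ q * F y"
    and l: "l < n"
  shows "a ^ w l * partial_deriv l F (wscale w a y) = a ^ q * partial_deriv l F y"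
proof -
  have upd: "wscale w a (y(l := t)) = (wscale w a y)(l := a ^ w l * t)" for t
    by (auto simp: wscale_def)
  have "((\<lambda>t. F ((wscale w a y)(l := a ^ w l * t))) has_field_derivative
      partial_deriv l F (wscale w a y) * a ^ w l) (at (y l))"
  proof (rule DERIV_chain2[where f = "\<lambda>t. F ((wscale w a y)(l := t))" and g = "\<lambda>t. a ^ w l * t"])
    show "((\<lambda>t. F ((wscale w a y)(l := t))) has_field_derivative
        partial_deriv l F (wscale w a y)) (at (a ^ w l * y l))"
      using polynomial_in_DERIV_coordinate[OF F l, of "wscale w a y"] by (simp add: wscale_def)
  qed (auto intro!: derivative_eq_intros)
  moreover have "((\<lambda>t. a ^ q * F (y(l := t))) has_field_derivative
      a ^ q * partial_deriv l F y) (at (y l))"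
    by (intro DERIV_cmult polynomial_in_DERIV_coordinate[OF F l])
  moreover have "(\<lambda>t. F ((wscale w a y)(l := a ^ w l * t))) = (\<lambda>t. a ^ q * F (y(l := t)))"
    by (simp add: hom flip: upd)
  ultimately show ?thesis
    by (metis DERIV_unique mult.commute)
qed

text \<open>Differentiate \<open>F (wscale w t y) = t ^ q * F y\<close> in \<open>t\<close> at
  \<open>t = 1\<close>.\<close>

lemma weighted_homogeneous_euler:
  assumes F: "polynomial_in n F"
    and hom: "\<And>a y. F (wscale w a y) = a ^ q * F y"
  shows "(\<Sum>l<n. partial_deriv l F y * (of_nat (w l) * y l)) = of_nat q * F y"
proof -
  have "((\<lambda>t. F (wscale w t y)) has_field_derivative
      (\<Sum>l<n. partial_deriv l F (wscale w 1 y) * (of_nat (w l) * y l))) (at 1)"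
    by (rule polynomial_in_DERIV_chain[OF F])
      (auto simp: wscale_def intro!: derivative_eq_intros)
  moreover have "((\<lambda>t. F (wscale w t y)) has_field_derivative of_nat q * F y) (at 1)"
    unfolding hom by (auto intro!: derivative_eq_intros)
  ultimately show ?thesis
    by (simp add: wscale_def DERIV_unique)
qed

section \<open>The remainder in a chart\<close>

lemma power_smallo_power_at_infinity:
  assumes "d < D"
  shows "(\<lambda>z :: complex. z ^ d) \<in> o[at_infinity](\<lambda>z. z ^ D)"
proof (rule smalloI_tendsto)
  have nz: "eventually (\<lambda>z :: complex. z \<noteq> 0) at_infinity"
    by (rule eventually_not_equal_at_infinity)
  then show "eventually (\<lambda>z :: complex. z ^ D \<noteq> 0) at_infinity"
    by eventually_elim simp
  have "((\<lambda>z :: complex. inverse (z ^ (D - d))) \<longlongrightarrow> 0) at_infinity"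
    using assms
    by (intro tendsto_inverse_0[THEN filterlim_compose] filterlim_power_at_infinity filterlim_ident) auto
  moreover have "eventually (\<lambda>z :: complex. inverse (z ^ (D - d)) = z ^ d / z ^ D) at_infinity"
    using nz by eventually_elim (use assms in \<open>simp add: power_diff field_simps\<close>)
  ultimately show "((\<lambda>z :: complex. z ^ d / z ^ D) \<longlongrightarrow> 0) at_infinity"
    by (rule Lim_transform_eventually)
qed

text \<open>Otherwise the largest index \<open>D\<close> with a nonzero coefficient is at least
  \<open>q\<close>. Subtracting the lower terms leaves \<open>h D * z ^ D\<close> of smaller order
  than \<open>z ^ D\<close>, so the constant \<open>h D\<close> would tend to 0.\<close>

lemma polyfun_smallo_imp_coeff_0:
  fixes h :: "nat \<Rightarrow> complex"
  assumes small: "(\<lambda>z. \<Sum>d\<le>N. h d * z ^ d) \<in> o[at_infinity](\<lambda>z. z ^ q)"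
    and d: "d \<le> N" "q \<le> d"
  shows "h d = 0"
proof (rule ccontr)
  assume "h d \<noteq> 0"
  define A where "A = {k. k \<le> N \<and> h k \<noteq> 0}"
  define D where "D = Max A"
  have A: "finite A" "d \<in> A"
    using d \<open>h d \<noteq> 0\<close> by (auto simp: A_def)
  then have "D \<in> A" "d \<le> D"
    unfolding D_def by (auto intro!: Max_in)
  then have D: "D \<le> N" "h D \<noteq> 0" "q \<le> D"
    using d by (auto simp: A_def)
  have above: "h k = 0" if "k \<le> N" "D < k" for k
  proof (rule ccontr)
    assume "h k \<noteq> 0"
    then have "k \<le> D"
      unfolding D_def using A(1) that by (intro Max_ge) (auto simp: A_def)
    then show False using that by simp
  qed
  have split: "(\<Sum>k\<le>N. h k * z ^ k) = h D * z ^ D + (\<Sum>k<D. h k * z ^ k)" for z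
  proof -
    have "(\<Sum>k\<le>N. h k * z ^ k) = (\<Sum>k\<le>D. h k * z ^ k)"
      using D above by (intro sum.mono_neutral_right) auto
    then show ?thesis
      by (simp add: add.commute flip: lessThan_Suc_atMost)
  qed
  have "(\<lambda>z :: complex. z ^ q) \<in> O[at_infinity](\<lambda>z. z ^ D)"
    using D(3) power_smallo_power_at_infinity[of q D]
    by (cases "q = D") (auto intro: landau_o.small_imp_big)
  then have "(\<lambda>z. \<Sum>k\<le>N. h k * z ^ k) \<in> o[at_infinity](\<lambda>z. z ^ D)"
    using small by (rule landau_o.small_big_trans[rotated])
  moreover have "(\<lambda>z. \<Sum>k<D. h k * z ^ k) \<in> o[at_infinity](\<lambda>z. z ^ D)"
  proof (rule big_sum_in_smallo)
    show "(\<lambda>z. h k * z ^ k) \<in> o[at_infinity](\<lambda>z. z ^ D)" if "k \<in> {..<D}" for k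
      using that power_smallo_power_at_infinity[of k D] by (cases "h k = 0") auto
  qed
  ultimately have "(\<lambda>z. (\<Sum>k\<le>N. h k * z ^ k) - (\<Sum>k<D. h k * z ^ k)) \<in> o[at_infinity](\<lambda>z. z ^ D)"
    by (rule sum_in_smallo)
  then have "(\<lambda>z. h D * z ^ D) \<in> o[at_infinity](\<lambda>z. z ^ D)"
    by (simp add: split)
  then have "((\<lambda>z. h D * z ^ D / z ^ D) \<longlongrightarrow> 0) at_infinity"
    by (rule smalloD_tendsto)
  moreover have "eventually (\<lambda>z. h D * z ^ D / z ^ D = h D) at_infinity"
    using eventually_not_equal_at_infinity[of 0] by eventually_elim simp
  ultimately have "((\<lambda>z :: complex. h D) \<longlongrightarrow> 0) at_infinity"
    by (rule Lim_transform_eventually)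
  then show False
    using D(2) tendsto_unique[OF trivial_limit_at_infinity tendsto_const] by metis
qed

lemma root_of_unity_power_eq_iff:
  assumes "s > 0" and "d \<le> q"
  shows "exp (2 * of_real pi * \<i> / of_nat s) ^ d = exp (2 * of_real pi * \<i> / of_nat s) ^ q
    \<longleftrightarrow> s dvd q - d"
proof -
  have "exp (2 * of_real pi * \<i> / of_nat s) ^ k = exp (2 * of_real pi * \<i> * of_nat k / of_nat s)" for k
    by (simp add: mult_ac flip: exp_of_nat_mult)
  then show ?thesis
    using assms complex_root_unity_eq[of s d q]
    by (metis Suc_leI One_nat_def mod_eq_dvd_iff_nat)
qed

lemma chart_slice_insert_index [simp]: "chart_slice j Y (insert_index j k) = Y k"
  by (simp add: chart_slice_def)

text \<open>The slice is 1 at position \<open>j\<close>, so that factor drops; the other positions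
  are the image of \<open>{0..<m}\<close> under \<open>insert_index j\<close>. The power
  \<open>E\<close> of \<open>\<epsilon> = Y m\<close> fills the last exponent.\<close>

lemma chart_monomial:
  assumes "j \<le> m"
  shows "(\<Prod>k<m + 1. chart_slice j Y k ^ \<alpha> k) * Y m ^ E
    = (\<Prod>k<m + 1. Y k ^ (if k < m then \<alpha> (insert_index j k) else E))"
proof -
  have "(\<Prod>k<m + 1. chart_slice j Y k ^ \<alpha> k) = (\<Prod>k\<in>{0..<Suc m} - {j}. chart_slice j Y k ^ \<alpha> k)"
    by (rule prod.mono_neutral_right) (auto simp: chart_slice_def)
  also have "\<dots> = (\<Prod>k\<in>insert_index j ` {0..<m}. chart_slice j Y k ^ \<alpha> k)"
    using assms by (simp add: insert_index_image)
  also have "\<dots> = (\<Prod>k<m. Y k ^ \<alpha> (insert_index j k))"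
    by (simp add: prod.reindex insert_index_inj_on lessThan_atLeast0)
  finally show ?thesis
    by simp
qed

definition weighted_degree :: "nat \<Rightarrow> (nat \<Rightarrow> nat) \<Rightarrow> (nat \<Rightarrow> nat) \<Rightarrow> nat" where
  "weighted_degree n w \<alpha> = (\<Sum>k<n. w k * \<alpha> k)"

lemma wscale_monomial:
  "(\<Prod>k<n. wscale w a y k ^ \<alpha> k) = a ^ weighted_degree n w \<alpha> * (\<Prod>k<n. y k ^ \<alpha> k)"
  by (simp add: wscale_def weighted_degree_def power_sum power_mult_distrib prod.distrib
      flip: power_mult)

text \<open>
  Uniqueness of the coefficients of a multivariate polynomial is avoided: what vanishes are the
  values of the weighted homogeneous components.
\<close>

lemma weighted_degrees_restricted:
  fixes F :: "(nat \<Rightarrow> complex) \<Rightarrow> complex"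
  assumes F: "\<And>y. F y = (\<Sum>\<alpha>\<in>S. a \<alpha> * (\<Prod>k<n. y k ^ \<alpha> k))" and S: "finite S" and s: "s > 0"
    and small: "\<And>y. (\<lambda>z. F (wscale w z y)) \<in> o[at_infinity](\<lambda>z. z ^ q)"
    and inv: "\<And>y. F (wscale w (exp (2 * of_real pi * \<i> / of_nat s)) y)
      = exp (2 * of_real pi * \<i> / of_nat s) ^ q * F y"
  shows "F y = (\<Sum>\<alpha> | \<alpha> \<in> S \<and> weighted_degree n w \<alpha> < q \<and> s dvd q - weighted_degree n w \<alpha>.
    a \<alpha> * (\<Prod>k<n. y k ^ \<alpha> k))"
proof -
  define \<omega> where "\<omega> = exp (2 * of_real pi * \<i> / of_nat s)"
  let ?deg = "weighted_degree n w"
  \<comment> \<open>The value at \<open>y\<close> of the component of weighted degree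
    \<open>d\<close>; it is the coefficient of \<open>z ^ d\<close> in
    \<open>F (wscale w z y)\<close>, seen as a polynomial in \<open>z\<close>.\<close>
  define h where "h y d = (\<Sum>\<alpha> | \<alpha> \<in> S \<and> ?deg \<alpha> = d. a \<alpha> * (\<Prod>k<n. y k ^ \<alpha> k))" for y d
  define N where "N = (\<Sum>\<alpha>\<in>S. ?deg \<alpha>)"
  have N: "?deg \<alpha> \<le> N" if "\<alpha> \<in> S" for \<alpha>
    unfolding N_def using S that by (intro member_le_sum) auto
  have scaled: "F (wscale w z y) = (\<Sum>d\<le>N. h y d * z ^ d)" for y z
  proof -
    have "F (wscale w z y) = (\<Sum>\<alpha>\<in>S. a \<alpha> * (\<Prod>k<n. y k ^ \<alpha> k) * z ^ ?deg \<alpha>)"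
      by (simp add: F wscale_monomial mult_ac)
    also have "\<dots> = (\<Sum>d\<le>N. \<Sum>\<alpha> | \<alpha> \<in> S \<and> ?deg \<alpha> = d. a \<alpha> * (\<Prod>k<n. y k ^ \<alpha> k) * z ^ ?deg \<alpha>)"
      using S N by (intro sum.group[symmetric]) auto
    also have "\<dots> = (\<Sum>d\<le>N. h y d * z ^ d)"
      by (auto simp: h_def sum_distrib_right intro!: sum.cong)
    finally show ?thesis .
  qed
  have high: "h y d = 0" if "d \<le> N" "q \<le> d" for d
    using small[of y] that unfolding scaled by (rule polyfun_smallo_imp_coeff_0)
  \<comment> \<open>Invariance at every dilated point is a polynomial identity in \<open>z\<close>.
    Comparing coefficients leaves only degrees with \<open>\<omega> ^ d = \<omega> ^ q\<close>,
    which for \<open>d < q\<close> means \<open>s dvd q - d\<close>.\<close>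
  have res: "h y d = 0 \<or> \<omega> ^ d = \<omega> ^ q" if "d \<le> N" for d
  proof -
    have "(\<Sum>d\<le>N. (h y d * (\<omega> ^ d - \<omega> ^ q)) * z ^ d) = 0" for z
    proof -
      have "wscale w \<omega> (wscale w z y) = wscale w (\<omega> * z) y"
        by (simp add: wscale_def power_mult_distrib mult.assoc)
      then have "F (wscale w (\<omega> * z) y) = \<omega> ^ q * F (wscale w z y)"
        using inv[of "wscale w z y"] by (simp add: \<omega>_def)
      then show ?thesis
        unfolding scaled by (simp add: algebra_simps power_mult_distrib sum_subtractf sum_distrib_left)
    qed
    then show ?thesis
      using that polyfun_eq_0[of "\<lambda>d. h y d * (\<omega> ^ d - \<omega> ^ q)" N] by auto
  qed
  have "wscale w 1 y = y"
    by (simp add: wscale_def)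
  then have "F y = (\<Sum>d\<le>N. h y d)"
    using scaled[of 1 y] by simp
  also have "\<dots> = (\<Sum>d\<in>{d. d \<le> N \<and> d < q \<and> s dvd q - d}. h y d)"
  proof (intro sum.mono_neutral_right ballI)
    fix d assume d: "d \<in> {..N} - {d. d \<le> N \<and> d < q \<and> s dvd q - d}"
    show "h y d = 0"
    proof (cases "q \<le> d")
      case False
      then have "\<omega> ^ d \<noteq> \<omega> ^ q"
        using d root_of_unity_power_eq_iff[OF s, of d q] by (simp add: \<omega>_def)
      then show ?thesis using res d by auto
    qed (use high d in auto)
  qed auto
  also have "\<dots> = (\<Sum>\<alpha> | \<alpha> \<in> S \<and> ?deg \<alpha> < q \<and> s dvd q - ?deg \<alpha>. a \<alpha> * (\<Prod>k<n. y k ^ \<alpha> k))"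
  proof -
    have "(\<Sum>\<alpha> | \<alpha> \<in> S \<and> ?deg \<alpha> < q \<and> s dvd q - ?deg \<alpha>. a \<alpha> * (\<Prod>k<n. y k ^ \<alpha> k))
        = (\<Sum>d\<in>{d. d \<le> N \<and> d < q \<and> s dvd q - d}.
            \<Sum>\<alpha> | \<alpha> \<in> {\<alpha> \<in> S. ?deg \<alpha> < q \<and> s dvd q - ?deg \<alpha>} \<and> ?deg \<alpha> = d. a \<alpha> * (\<Prod>k<n. y k ^ \<alpha> k))"
      using S N by (intro sum.group[symmetric]) auto
    also have "\<dots> = (\<Sum>d\<in>{d. d \<le> N \<and> d < q \<and> s dvd q - d}. h y d)"
      unfolding h_def by (intro sum.cong) auto
    finally show ?thesis ..
  qed
  finally show ?thesis .
qed

text \<open>By growth and invariance \<open>g i\<close> is a sum of monomials of weighted degree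
  \<open>d < p i + 1\<close> with \<open>p i + 1 - d = (r + 1) * e\<close>. In the chart each
  contributes \<open>inverse \<eta> ^ d\<close>, which is the prescribed prefactor times a natural
  power of \<open>\<epsilon>\<close>.\<close>

lemma is_chart_remainder_exists:
  assumes poly: "polynomial_in (m + 1) (g i)" and j: "j \<le> m"
    and small: "\<And>y. (\<lambda>z. g i (wscale (weights m p r) z y)) \<in> o[at_infinity](\<lambda>z. z ^ (p i + 1))"
    and inv: "\<And>y. g i (wscale (weights m p r) (exp (2 * of_real pi * \<i> / of_nat (r + 1))) y)
      = exp (2 * of_real pi * \<i> / of_nat (r + 1)) ^ (p i + 1) * g i y"
  shows "\<exists>G. is_chart_remainder m p r g j i G"
proof -
  obtain S a where S: "finite S" and g: "\<And>y. g i y = (\<Sum>\<alpha>\<in>S. a \<alpha> * (\<Prod>k<m + 1. y k ^ \<alpha> k))"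
    using poly unfolding polynomial_in_def by blast
  let ?deg = "weighted_degree (m + 1) (weights m p r)"
  define T where "T = {\<alpha> \<in> S. ?deg \<alpha> < p i + 1 \<and> r + 1 dvd (p i + 1) - ?deg \<alpha>}"
  \<comment> \<open>On \<open>T\<close> the quotient is at least 1; the prefactor already contains
    one factor \<open>\<eta> ^ (r + 1) = \<epsilon>\<close>, hence the \<open>- 1\<close>.\<close>
  define E where "E \<alpha> = ((p i + 1) - ?deg \<alpha>) div (r + 1) - 1" for \<alpha>
  define G where "G Y = (\<Sum>\<alpha>\<in>T. a \<alpha> * ((\<Prod>k<m + 1. chart_slice j Y k ^ \<alpha> k) * Y m ^ E \<alpha>))" for Y
  have gT: "g i y = (\<Sum>\<alpha>\<in>T. a \<alpha> * (\<Prod>k<m + 1. y k ^ \<alpha> k))" for y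
    unfolding T_def by (rule weighted_degrees_restricted[OF g S _ small inv]) simp
  have "polynomial_in (m + 1) G"
  proof (rule polynomial_in_sum_monomials)
    show "finite T" using S by (simp add: T_def)
    show "G Y = (\<Sum>\<alpha>\<in>T. a \<alpha> *
        (\<Prod>k<m + 1. Y k ^ (if k < m then \<alpha> (insert_index j k) else E \<alpha>)))" for Y
      by (simp only: G_def chart_monomial[OF j])
  qed
  moreover have "g i (wscale (weights m p r) (inverse \<eta>) (chart_slice j Y))
      = \<eta> powi (int (r + 1) - (1 + int (p i))) * G Y"
    if \<eta>: "\<eta> \<noteq> 0" "Y m = \<eta> ^ (r + 1)" for Y \<eta>
  proof -
    have pow: "inverse \<eta> ^ ?deg \<alpha> = \<eta> powi (int (r + 1) - (1 + int (p i))) * Y m ^ E \<alpha>"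
      if \<alpha>: "\<alpha> \<in> T" for \<alpha>
    proof -
      have lt: "?deg \<alpha> < p i + 1" and dvd: "r + 1 dvd (p i + 1) - ?deg \<alpha>"
        using \<alpha> by (auto simp: T_def)
      obtain e where e: "(p i + 1) - ?deg \<alpha> = (r + 1) * e"
        using dvd by blast
      moreover have r_nz: "r + 1 \<noteq> 0" by simp
      moreover have "e > 0"
        using e lt by (cases e) auto
      ultimately have "(p i + 1) - ?deg \<alpha> = (r + 1) + (r + 1) * E \<alpha>"
        unfolding E_def e nonzero_mult_div_cancel_left[OF r_nz] by (cases e) auto
      then have eq: "- int (?deg \<alpha>) = (int (r + 1) - (1 + int (p i))) + int ((r + 1) * E \<alpha>)"
        using lt by linarith
      have "inverse \<eta> ^ ?deg \<alpha> = \<eta> powi (- int (?deg \<alpha>))"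
        by (simp add: power_int_minus power_inverse)
      also have "\<dots> = \<eta> powi (int (r + 1) - (1 + int (p i))) * \<eta> ^ ((r + 1) * E \<alpha>)"
        unfolding eq using \<eta>(1) by (subst power_int_add) (auto simp only: power_int_of_nat)
      finally show ?thesis
        by (simp only: \<eta>(2) power_mult)
    qed
    show ?thesis
      unfolding gT G_def wscale_monomial sum_distrib_left
      by (intro sum.cong refl) (simp only: pow mult_ac)
  qed
  ultimately show ?thesis
    unfolding is_chart_remainder_def by blast
qed

text \<open>Where \<open>\<epsilon> = Y m\<close> is nonzero it has an \<open>(r + 1)\<close>-th
  root \<open>\<eta>\<close>, and the defining identity can be solved for \<open>G Y\<close>. The
  values at \<open>\<epsilon> = 0\<close> follow by continuity in \<open>\<epsilon>\<close>.\<close>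

lemma is_chart_remainder_unique:
  assumes G: "is_chart_remainder m p r g j i G" and G': "is_chart_remainder m p r g j i G'"
  shows "G = G'"
proof
  fix Y
  have off: "G Y = G' Y" if "Y m \<noteq> 0" for Y
  proof -
    define \<eta> where "\<eta> = exp (Ln (Y m) / of_nat (r + 1))"
    have "\<eta> ^ (r + 1) = Y m"
      unfolding \<eta>_def using that by (subst exp_of_nat_mult[symmetric]) (auto simp del: of_nat_add of_nat_Suc)
    moreover have "\<eta> \<noteq> 0"
      by (simp add: \<eta>_def)
    ultimately have "\<eta> powi (int (r + 1) - (1 + int (p i))) * G Y
        = \<eta> powi (int (r + 1) - (1 + int (p i))) * G' Y"
      using G G' unfolding is_chart_remainder_def by metis
    then show ?thesis
      using \<open>\<eta> \<noteq> 0\<close> by simp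
  qed
  have cont: "isCont (\<lambda>t. H (Y(m := t))) (Y m)" if "is_chart_remainder m p r g j i H" for H
    using that polynomial_in_DERIV_coordinate[of "m + 1" H m Y]
    by (auto simp: is_chart_remainder_def intro: DERIV_isCont)
  show "G Y = G' Y"
  proof (cases "Y m = 0")
    case True
    have "((\<lambda>t. G (Y(m := t)) - G' (Y(m := t))) \<longlongrightarrow> G (Y(m := 0)) - G' (Y(m := 0))) (at 0)"
      using cont[OF G] cont[OF G'] unfolding True isCont_def by (rule tendsto_diff)
    moreover have "eventually (\<lambda>t. G (Y(m := t)) - G' (Y(m := t)) = 0) (at 0)"
      by (rule eventually_at_topological[THEN iffD2], rule exI[of _ UNIV]) (auto simp: off)
    ultimately have "((\<lambda>t :: complex. 0) \<longlongrightarrow> G (Y(m := 0)) - G' (Y(m := 0))) (at 0)"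
      by (rule Lim_transform_eventually)
    then have "G (Y(m := 0)) - G' (Y(m := 0)) = 0"
      by (simp add: tendsto_const_iff)
    moreover have "Y(m := 0) = Y"
      using True by auto
    ultimately show ?thesis by simp
  qed (rule off)
qed

lemma polynomial_in_chart_remainder:
  assumes "\<exists>G. is_chart_remainder m p r g j i G"
  shows "polynomial_in (m + 1) (chart_remainder m p r g j i)"
proof -
  obtain G where G: "is_chart_remainder m p r g j i G"
    using assms by blast
  then have "chart_remainder m p r g j i = G"
    unfolding chart_remainder_def by (blast intro: the_equality is_chart_remainder_unique)
  with G show ?thesis
    by (simp add: is_chart_remainder_def)
qed

section \<open>The Jacobi matrices\<close>

text \<open>Let \<open>v l = p l * c l\<close>. Euler's identity at \<open>(c, 0)\<close> in degree
  \<open>p i + 1\<close> and the root equation give \<open>- (p i + 1) * v i\<close> for the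
  derivative part of \<open>K v\<close>; the diagonal adds \<open>p i * v i\<close>, leaving
  \<open>- v i\<close>. As \<open>v j \<noteq> 0\<close>, the matrix can be deflated.\<close>

lemma kovalevskaya_exponents_deflate:
  fixes p :: "nat \<Rightarrow> nat"
  assumes f_poly: "\<And>i. i < m \<Longrightarrow> polynomial_in (m + 1) (f i)"
    and A1: "\<And>i a y. i < m \<Longrightarrow> f i (wscale (weights m p r) a y) = a ^ (p i + 1) * f i y"
    and root: "\<And>i. i < m \<Longrightarrow> - of_nat (p i) * c i = autonomous_part m f i c"
    and j: "j < m" "c j \<noteq> 0" "p j > 0"
  shows "kovalevskaya_exponents m p f c = {#-1#} + eigenvalue_mset
    (Matrix.mat (m - 1) (m - 1) (\<lambda>(k, l).
      kovalevskaya_matrix m p f c $$ (insert_index j k, insert_index j l)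
        - (of_nat (p (insert_index j k)) * c (insert_index j k)) / (of_nat (p j) * c j)
          * kovalevskaya_matrix m p f c $$ (j, insert_index j l)))"
proof -
  let ?K = "kovalevskaya_matrix m p f c"
  let ?y = "c(m := 0)"
  have pd: "partial_deriv l (autonomous_part m f i) c = partial_deriv l (f i) ?y" if "l < m" for i l
    using that by (simp add: partial_deriv_def autonomous_part_def fun_upd_twist)
  have "(\<Sum>l<m. ?K $$ (i, l) * (of_nat (p l) * c l)) = -1 * (of_nat (p i) * c i)" if i: "i < m" for i
  proof -
    have "(\<Sum>l<m + 1. partial_deriv l (f i) ?y * (of_nat (weights m p r l) * ?y l))
        = of_nat (p i + 1) * f i ?y"
      using i by (intro weighted_homogeneous_euler f_poly A1)
    then have euler: "(\<Sum>l<m. partial_deriv l (f i) ?y * (of_nat (p l) * c l))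
        = of_nat (p i + 1) * (- of_nat (p i) * c i)"
      unfolding root[OF i] by (simp add: weights_def autonomous_part_def)
    have "?K $$ (i, l) * (of_nat (p l) * c l) = partial_deriv l (f i) ?y * (of_nat (p l) * c l)
        + (if l = i then of_nat (p i) * (of_nat (p i) * c i) else 0)" if "l < m" for l
      using i that by (simp add: kovalevskaya_matrix_def pd distrib_right)
    then have "(\<Sum>l<m. ?K $$ (i, l) * (of_nat (p l) * c l))
        = (\<Sum>l<m. partial_deriv l (f i) ?y * (of_nat (p l) * c l)
          + (if l = i then of_nat (p i) * (of_nat (p i) * c i) else 0))"
      by (intro sum.cong) auto
    also have "\<dots> = of_nat (p i + 1) * (- of_nat (p i) * c i) + of_nat (p i) * (of_nat (p i) * c i)"
      using i by (simp add: sum.distrib euler)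
    finally show ?thesis
      by (simp add: algebra_simps)
  qed
  then have char: "char_poly ?K = [:1, 1:] * char_poly (Matrix.mat (m - 1) (m - 1) (\<lambda>(k, l).
      ?K $$ (insert_index j k, insert_index j l)
        - (of_nat (p (insert_index j k)) * c (insert_index j k)) / (of_nat (p j) * c j)
          * ?K $$ (j, insert_index j l)))" (is "_ = _ * char_poly ?N")
    using char_poly_deflate[of ?K m j "\<lambda>l. of_nat (p l) * c l" "-1"] j
    by (simp add: kovalevskaya_matrix_def)
  have "char_poly ?N \<noteq> 0"
    using degree_monic_char_poly[of ?N "m - 1"] by auto
  then show ?thesis
    unfolding kovalevskaya_exponents_def eigenvalue_mset_def char
    by (subst proots_mult) auto
qed

lemma eigenvalue_mset_two_last_rows:
  assumes A: "A \<in> carrier_mat (Suc (Suc n)) (Suc (Suc n))"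
    and zero: "\<And>k. k < Suc n \<Longrightarrow> A $$ (Suc n, k) = 0" "\<And>k. k < n \<Longrightarrow> A $$ (n, k) = 0"
  shows "eigenvalue_mset A = {#A $$ (n, n), A $$ (Suc n, Suc n)#}
    + eigenvalue_mset (Matrix.mat n n (\<lambda>(k, l). A $$ (k, l)))"
proof -
  define B where "B = Matrix.mat n n (\<lambda>(k, l). A $$ (k, l))"
  have nz: "char_poly B \<noteq> 0"
    using degree_monic_char_poly[of B n] by (auto simp: B_def)
  have char: "char_poly A = [:- (A $$ (Suc n, Suc n)), 1:] * ([:- (A $$ (n, n)), 1:] * char_poly B)"
    unfolding B_def using zero by (rule char_poly_two_last_rows[OF A])
  show ?thesis
    using nz unfolding eigenvalue_mset_def char B_def[symmetric]
    by (simp add: proots_mult del: mult_pCons_left)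
qed

lemma chart_slice_upd:
  "chart_slice j (Y(l := t)) = (chart_slice j Y)(insert_index j l := t)"
  by (rule ext) (auto simp: chart_slice_def insert_delete_index)

text \<open>Dilation of \<open>(c, 0)\<close> by \<open>inverse b\<close> turns the entry
  \<open>c j\<close> into 1, because \<open>b ^ p j = c j\<close>. The fixed point thus lies on the
  weighted orbit of the root, and homogeneity carries the data of \<open>f\<close> from one to the
  other.\<close>

lemma chart_slice_root_point:
  assumes j: "j < m" and b: "b \<noteq> 0" "b ^ p j = c j" and k: "k < m + 1"
  shows "chart_slice j (root_point m p j c b) k = wscale (weights m p r) (inverse b) (c(m := 0)) k"
proof (cases "k = j \<or> k = m")
  case True
  then show ?thesis
    using j b(1) b(2)[symmetric]
    by (auto simp: chart_slice_def root_point_def wscale_def weights_def delete_index_def power_inverse)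
next
  case False
  then have "delete_index j k < m - 1"
    using k j by (auto simp: delete_index_def)
  then show ?thesis
    using False b(1)
    by (simp add: chart_slice_def root_point_def wscale_def weights_def insert_delete_index
        power_int_minus power_inverse mult.commute)
qed

theorem theorem3p4:
  fixes m r j :: nat
    and p :: "nat \<Rightarrow> nat"
    and f g :: "nat \<Rightarrow> (nat \<Rightarrow> complex) \<Rightarrow> complex"
    and c :: "nat \<Rightarrow> complex"
    and b :: complex
  assumes f_poly: "\<And>i. i < m \<Longrightarrow> polynomial_in (m + 1) (f i)"
    and g_poly: "\<And>i. i < m \<Longrightarrow> polynomial_in (m + 1) (g i)"
    and p_pos: "\<And>i. i < m \<Longrightarrow> p i > 0"
    and r_pos: "r > 0"
    and A1: "\<And>i a y. i < m \<Longrightarrow> f i (wscale (weights m p r) a y) = a ^ (p i + 1) * f i y"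
    and A2: "\<And>i y. i < m \<Longrightarrow>
               (\<lambda>a. g i (wscale (weights m p r) a y)) \<in> o[at_infinity](\<lambda>a. a ^ (p i + 1))"
    and A3: "system_invariant m p r (\<lambda>i y. f i y + g i y)
               (exp (2 * of_real pi * \<i> / of_nat (r + 1)))"
    and root: "\<And>i. i < m \<Longrightarrow> - of_nat (p i) * c i = autonomous_part m f i c"
    and j: "j < m" "c j \<noteq> 0"
    and branch: "b ^ p j = c j"
  shows "chart_rhs m p r f g j j (root_point m p j c b) \<noteq> 0
      \<and> (\<forall>k < m + 1. rational_field m p r f g j (root_point m p j c b) k = 0)
      \<and> -1 \<in># kovalevskaya_exponents m p f c
      \<and> eigenvalue_mset (jacobi_matrix (m + 1) (rational_field m p r f g j) (root_point m p j c b))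
          = {#of_nat r, of_nat (r + 1)#} + (kovalevskaya_exponents m p f c - {#-1#})
      \<and> (\<forall>k < m + 1. polynomial_field m p r f g j (root_point m p j c b) k = 0)
      \<and> (\<exists>\<kappa>. \<kappa> \<noteq> 0 \<and>
           eigenvalue_mset (jacobi_matrix (m + 1) (polynomial_field m p r f g j) (root_point m p j c b))
             = image_mset (\<lambda>\<mu>. \<kappa> * \<mu>)
                 (eigenvalue_mset (jacobi_matrix (m + 1) (rational_field m p r f g j) (root_point m p j c b))))"
proof -

  \<comment> \<open>Notation and the dilation between root and fixed point\<close>
  define n where "n = m - 1"
  have m: "m = Suc n"
    using j by (simp add: n_def)
  have n_eq: "m - Suc 0 = n" "m - 1 = n"
    by (simp_all add: n_def)
  have n_m: "n < m" "\<not> m < n" "m \<noteq> n" and lt_m: "\<And>k. k < n \<Longrightarrow> k < m"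
    by (simp_all add: m)
  define a where "a = inverse b"
  define P where "P = root_point m p j c b"
  define Q where "Q = chart_slice j P"
  let ?C = "c(m := 0)"
  let ?w = "weights m p r"
  have b0: "b \<noteq> 0"
    using branch j p_pos[of j] by (auto simp: power_0_left)
  then have a0: "a \<noteq> 0" and ab: "a * b = 1"
    by (auto simp: a_def)
  have pj: "of_nat (p j) \<noteq> (0 :: complex)" "p j > 0"
    using p_pos[of j] j by auto
  have aj: "a ^ p j * c j = 1"
    using b0 branch[symmetric] by (simp add: a_def power_inverse)
  have ins: "insert_index j k < m" "insert_index j k \<noteq> j" if "k < n" for k
    using that j m by (auto simp: insert_index_def)
  have insm: "insert_index j k < m + 1" if "k < m" for k
    using that by (auto simp: insert_index_def)
  have Q: "Q k = wscale ?w a ?C k" if "k < m + 1" for k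
    unfolding Q_def P_def a_def using that j(1) b0 branch by (intro chart_slice_root_point)
  have Pm: "P m = 0" "P n = 0"
    by (auto simp: P_def root_point_def m)
  have P: "P k = a ^ p (insert_index j k) * c (insert_index j k)" if "k < n" for k
    using that b0 by (simp add: P_def root_point_def m a_def power_int_minus power_inverse)

  \<comment> \<open>Values and derivatives of \<open>f\<close> at the fixed point\<close>
  define D where "D i l = partial_deriv l (f i) Q" for i l
  define D0 where "D0 i l = partial_deriv l (f i) ?C" for i l
  \<comment> \<open>The value of the denominator \<open>f j + \<epsilon> G j\<close> at the fixed
    point; it becomes the constant factor between the two spectra.\<close>
  define \<phi> where "\<phi> = f j Q"
  have fQ: "f i Q = - (a ^ (p i + 1) * (of_nat (p i) * c i))" if i: "i < m" for i
  proof -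
    have "f i Q = f i (wscale ?w a ?C)"
      using Q by (intro polynomial_in_cong[OF f_poly[OF i]])
    also have "\<dots> = a ^ (p i + 1) * f i ?C"
      by (rule A1[OF i])
    also have "f i ?C = - of_nat (p i) * c i"
      unfolding root[OF i] by (simp add: autonomous_part_def)
    finally show ?thesis by simp
  qed
  \<comment> \<open>Since \<open>a ^ p j * c j = 1\<close>, only one power of \<open>a\<close>
    survives.\<close>
  have \<phi>: "\<phi> = - (a * of_nat (p j))"
    using fQ[OF j(1)] aj by (simp add: \<phi>_def mult_ac)
  then have \<phi>0: "\<phi> \<noteq> 0"
    using a0 pj by simp
  have D: "D i l = a ^ (p i + 1) * D0 i l / a ^ p l" if "i < m" "l < m" for i l
  proof -
    have "D i l = partial_deriv l (f i) (wscale ?w a ?C)"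
      unfolding D_def using that Q by (intro partial_deriv_cong[OF f_poly]) auto
    moreover have "a ^ ?w l * partial_deriv l (f i) (wscale ?w a ?C) = a ^ (p i + 1) * D0 i l"
      unfolding D0_def
      using that by (intro weighted_homogeneous_partial_deriv[OF f_poly] A1) auto
    ultimately show ?thesis
      using a0 that by (simp add: weights_def field_simps)
  qed

  \<comment> \<open>The chart functions near the fixed point\<close>
  define F where "F i Y = f i (chart_slice j Y)" for i Y
  have DERIV_F: "((\<lambda>t. F i (P(l := t))) has_field_derivative D i (insert_index j l)) (at (P l))"
    if "i < m" "l < m" for i l
  proof -
    have "((\<lambda>t. f i (Q(insert_index j l := t))) has_field_derivative D i (insert_index j l))
        (at (Q (insert_index j l)))"
      unfolding D_def using that insm by (intro polynomial_in_DERIV_coordinate[OF f_poly]) auto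
    then show ?thesis
      by (simp add: F_def chart_slice_upd Q_def)
  qed
  have FP: "F i P = f i Q" for i
    by (simp add: F_def Q_def)

  let ?h = "\<lambda>i. chart_rhs m p r f g j i"
  have h: "?h i Y = F i Y" if "Y m = 0" for i Y
    using that by (simp add: chart_rhs_def F_def)
  have hP: "?h i P = f i Q" for i
    using Pm by (simp add: h FP)
  have h_upd: "?h i (P(l := t)) = F i (P(l := t))" if "l < m" for i l t
    using that Pm by (intro h) auto

  \<comment> \<open>Regularity of \<open>G\<^sub>j\<close> matters only for the \<open>\<epsilon>\<epsilon>\<close>-entry of the polynomial field, which contains
    \<open>\<epsilon> \<cdot> \<epsilon> G\<^sub>j\<close>; the entries \<open>\<partial>/\<partial>\<epsilon>\<close> of the \<open>X\<close>- and \<open>Z\<close>-rows lie above the diagonal.\<close>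
  have DERIV_G: "\<exists>G'. ((\<lambda>t. chart_remainder m p r g j j (P(m := t))) has_field_derivative G') (at 0)"
  proof -
    let ?\<omega> = "exp (2 * of_real pi * \<i> / of_nat (r + 1)) :: complex"
    have \<omega>: "?\<omega> ^ (r + 1) = 1"
      using root_of_unity_power_eq_iff[of "r + 1" 0 "r + 1"] by (simp del: power_Suc)
    \<comment> \<open>Invariance is assumed for \<open>f j + g j\<close>. As
      \<open>\<omega> ^ (r + 1) = 1\<close>, its factor \<open>\<omega> ^ p j / \<omega> ^ r\<close>
      equals \<open>\<omega> ^ (p j + 1)\<close>, by which \<open>f j\<close> scales on its own;
      subtraction gives the same for \<open>g j\<close>.\<close>
    have "g j (wscale ?w ?\<omega> y) = ?\<omega> ^ (p j + 1) * g j y" for y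
    proof -
      have "f j (wscale ?w ?\<omega> y) + g j (wscale ?w ?\<omega> y) = (?\<omega> ^ p j / ?\<omega> ^ r) * (f j y + g j y)"
        using A3 j(1) unfolding system_invariant_def by blast
      moreover have "?\<omega> ^ p j / ?\<omega> ^ r = ?\<omega> ^ (p j + 1)"
        using \<omega> by (simp add: field_simps del: of_nat_Suc of_nat_add)
      ultimately show ?thesis
        by (simp only: A1[OF j(1)] distrib_left add_left_cancel)
    qed
    then have "polynomial_in (m + 1) (chart_remainder m p r g j j)"
      using g_poly A2 j(1)
      by (intro polynomial_in_chart_remainder is_chart_remainder_exists) auto
    from polynomial_in_DERIV_coordinate[OF this, of m P] show ?thesis
      using Pm by auto
  qed

  \<comment> \<open>The \<open>X\<close>-block and the deflated Kovalevskaya matrix\<close>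
  define M where "M = Matrix.mat n n (\<lambda>(k, l).
    (if k = l then of_nat (p (insert_index j k)) else 0)
      - of_nat (p j) * ((D (insert_index j k) (insert_index j l) * \<phi>
          - f (insert_index j k) Q * D j (insert_index j l)) / (\<phi> * \<phi>)))"
  have M: "M \<in> carrier_mat n n"
    by (simp add: M_def)
  let ?K = "kovalevskaya_matrix m p f c"
  let ?N = "Matrix.mat n n (\<lambda>(k, l).
      ?K $$ (insert_index j k, insert_index j l)
        - (of_nat (p (insert_index j k)) * c (insert_index j k)) / (of_nat (p j) * c j)
          * ?K $$ (j, insert_index j l))"
  have K: "?K $$ (i, l) = D0 i l + (if i = l then of_nat (p i) else 0)" if "i < m" "l < m" for i l
    using that
    by (simp add: kovalevskaya_matrix_def D0_def partial_deriv_def autonomous_part_def fun_upd_twist)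
  \<comment> \<open>\<open>M\<close> is the quotient rule with derivatives taken at
    \<open>Q\<close>, whereas \<open>?N\<close> takes them at \<open>c\<close>. By the homogeneity
    degrees the passage is conjugation by the diagonal matrix of the \<open>a ^ p i\<close>.\<close>
  have "M = Matrix.mat n n (\<lambda>(k, l). a ^ p (insert_index j k) / a ^ p (insert_index j l) * ?N $$ (k, l))"
  proof (rule eq_matI, goal_cases)
    case (1 k l)
    then have kl: "k < n" "l < n" by auto
    let ?i = "insert_index j k" and ?l = "insert_index j l"
    have eq: "?i = ?l \<longleftrightarrow> k = l"
      by (metis delete_insert_index)
    \<comment> \<open>Division by \<open>\<phi> = - a * p j\<close> cancels \<open>p j\<close> and
      lowers \<open>a ^ (p i + 1)\<close> to \<open>a ^ p i\<close>.\<close>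
    have D1: "of_nat (p j) * (D ?i ?l * \<phi> / (\<phi> * \<phi>)) = - (a ^ p ?i * D0 ?i ?l / a ^ p ?l)"
      using kl a0 pj(1) ins by (simp add: D \<phi>)
    have "of_nat (p j) * (f ?i Q * D j ?l / (\<phi> * \<phi>))
        = - (a ^ p ?i * (of_nat (p ?i) * c ?i) * (a ^ p j * D0 j ?l) / (of_nat (p j) * a ^ p ?l))"
      using kl a0 pj(1) ins j by (simp add: D \<phi> fQ field_simps)
    \<comment> \<open>This supplies the \<open>c j\<close> in the denominator of the ratio
      \<open>v i / v j\<close> of eigenvector entries.\<close>
    also have "a ^ p j = 1 / c j"
      using aj j(2) by (simp add: field_simps)
    finally have D2: "of_nat (p j) * (f ?i Q * D j ?l / (\<phi> * \<phi>))
        = - (a ^ p ?i / a ^ p ?l * ((of_nat (p ?i) * c ?i) / (of_nat (p j) * c j) * D0 j ?l))"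
      by (simp add: mult_ac)
    let ?\<delta> = "if k = l then of_nat (p ?i) else (0 :: complex)"
    have "M $$ (k, l) = ?\<delta>
        - of_nat (p j) * ((D ?i ?l * \<phi> - f ?i Q * D j ?l) / (\<phi> * \<phi>))"
      unfolding M_def using kl by simp
    also have "\<dots> = ?\<delta> + a ^ p ?i * D0 ?i ?l / a ^ p ?l
        - a ^ p ?i / a ^ p ?l * ((of_nat (p ?i) * c ?i) / (of_nat (p j) * c j) * D0 j ?l)"
      unfolding diff_divide_distrib right_diff_distrib D1 D2 by simp
    finally have M_kl: "M $$ (k, l) = ?\<delta> + a ^ p ?i * D0 ?i ?l / a ^ p ?l
        - a ^ p ?i / a ^ p ?l * ((of_nat (p ?i) * c ?i) / (of_nat (p j) * c j) * D0 j ?l)" .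
    have \<delta>: "a ^ p ?i / a ^ p ?l * ?\<delta> = ?\<delta>"
      using a0 by simp
    have "j \<noteq> ?l"
      by (metis insert_index_exclude)
    then have K_jl: "?K $$ (j, ?l) = D0 j ?l"
      using K[OF j(1) ins(1)[OF kl(2)]] by (simp only: if_False add_0_right)
    have N_kl: "?N $$ (k, l) = D0 ?i ?l + ?\<delta>
        - (of_nat (p ?i) * c ?i) / (of_nat (p j) * c j) * D0 j ?l"
      using kl by (simp add: K_jl K[OF ins(1)[OF kl(1)] ins(1)[OF kl(2)]] eq)
    have "M $$ (k, l) = a ^ p ?i / a ^ p ?l * ?N $$ (k, l)"
      unfolding M_kl N_kl right_diff_distrib distrib_left \<delta> by simp
    then show ?case
      using kl by simp
  qed (auto simp: M_def)
  then have "char_poly M = char_poly ?N"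
    using char_poly_diagonal_conjugate[of ?N n "\<lambda>k. a ^ p (insert_index j k)"] a0 by simp
  then have K_M: "kovalevskaya_exponents m p f c = {#-1#} + eigenvalue_mset M"
    using kovalevskaya_exponents_deflate[of m f p r c j] f_poly A1 root j pj
    by (simp add: eigenvalue_mset_def m)

  \<comment> \<open>Entries of the two Jacobi matrices\<close>
  let ?V = "rational_field m p r f g j" and ?W = "polynomial_field m p r f g j"
  define JV JW where "JV = jacobi_matrix (m + 1) ?V P" and "JW = jacobi_matrix (m + 1) ?W P"
  \<comment> \<open>The fixed point equation of the \<open>X\<close>-rows; it also simplifies the
    product rule for the polynomial field.\<close>
  have pfix: "of_nat (p j) * (f (insert_index j k) Q / \<phi>) = of_nat (p (insert_index j k)) * P k"
    if "k < n" for k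
    using that a0 pj ins[OF that] by (simp add: fQ \<phi> P)
  have V0: "?V P k = 0" if "k < m + 1" for k
    using that Pm pfix[of k] by (auto simp: rational_field_def n_eq hP \<phi>_def[symmetric])
  have W0: "?W P k = 0" if "k < m + 1" for k
    using that Pm pfix[of k] \<phi>0
    by (auto simp: polynomial_field_def n_eq hP \<phi>_def[symmetric] field_simps)

  have JV_entry: "JV $$ (k, l) = V'"
    if "((\<lambda>t. ?V (P(l := t)) k) has_field_derivative V') (at (P l))" "k < m + 1" "l < m + 1" for k l V'
    using that by (simp add: JV_def JW_def jacobi_matrix_def partial_deriv_def DERIV_imp_deriv)
  have JW_entry: "JW $$ (k, l) = W'"
    if "((\<lambda>t. ?W (P(l := t)) k) has_field_derivative W') (at (P l))" "k < m + 1" "l < m + 1" for k l W'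
    using that by (simp add: JV_def JW_def jacobi_matrix_def partial_deriv_def DERIV_imp_deriv)
  have DERIV_upd: "((\<lambda>t. (P(l := t)) k) has_field_derivative (if k = l then 1 else 0)) (at x)" for k l x
    by auto

  have V_block: "JV $$ (k, l) = M $$ (k, l)" if kl: "k < n" "l < n" for k l
  proof (rule JV_entry)
    let ?i = "insert_index j k"
    have "((\<lambda>t. of_nat (p ?i) * (P(l := t)) k - of_nat (p j) * (F ?i (P(l := t)) / F j (P(l := t))))
        has_field_derivative M $$ (k, l)) (at (P l))"
      using kl ins[OF kl(1)] j m \<phi>0
      by (intro DERIV_cong[OF DERIV_diff[OF DERIV_cmult[OF DERIV_upd]
            DERIV_cmult[OF DERIV_divide[OF DERIV_F DERIV_F]]]])
        (auto simp: M_def FP \<phi>_def)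
    then show "((\<lambda>t. ?V (P(l := t)) k) has_field_derivative M $$ (k, l)) (at (P l))"
      using kl by (simp add: rational_field_def n_eq lt_m h_upd del: fun_upd_apply)
  qed (use kl m in auto)
  have W_block: "JW $$ (k, l) = \<phi> * M $$ (k, l)" if kl: "k < n" "l < n" for k l
  proof (rule JW_entry)
    let ?i = "insert_index j k"
    \<comment> \<open>The product rule yields an extra term with \<open>p i * P k\<close>. Replacing
      it by \<open>p j * f i / \<phi>\<close> restores the second term of the quotient rule,
      multiplied by \<open>\<phi>\<close>.\<close>
    have "(if k = l then of_nat (p ?i) else 0) * \<phi> + D j (insert_index j l) * (of_nat (p ?i) * P k)
        - of_nat (p j) * D ?i (insert_index j l) = \<phi> * M $$ (k, l)"
      unfolding pfix[OF kl(1), symmetric] using kl \<phi>0 by (simp add: M_def field_simps)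
    then have "((\<lambda>t. of_nat (p ?i) * (P(l := t)) k * F j (P(l := t)) - of_nat (p j) * F ?i (P(l := t)))
        has_field_derivative \<phi> * M $$ (k, l)) (at (P l))"
      using kl ins[OF kl(1)] j m
      by (intro DERIV_cong[OF DERIV_diff[OF DERIV_mult[OF DERIV_cmult[OF DERIV_upd] DERIV_F]
            DERIV_cmult[OF DERIV_F]]])
        (auto simp: FP \<phi>_def)
    then show "((\<lambda>t. ?W (P(l := t)) k) has_field_derivative \<phi> * M $$ (k, l)) (at (P l))"
      using kl by (simp add: polynomial_field_def n_eq lt_m h_upd del: fun_upd_apply)
  qed (use kl m in auto)

  \<comment> \<open>For \<open>l < m\<close> the point keeps \<open>\<epsilon> = 0\<close>, so the
    numerator \<open>p j * \<epsilon>\<close> vanishes identically and only the linear term in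
    \<open>Z\<close> contributes.\<close>
  have V_Z: "JV $$ (n, l) = (if l = n then of_nat r else 0)" if l: "l < Suc n" for l
  proof (rule JV_entry)
    have "((\<lambda>t. of_nat r * (P(l := t)) n) has_field_derivative (if l = n then of_nat r else 0)) (at (P l))"
      by (rule DERIV_cong[OF DERIV_cmult[OF DERIV_upd]]) auto
    then show "((\<lambda>t. ?V (P(l := t)) n) has_field_derivative (if l = n then of_nat r else 0)) (at (P l))"
      using l Pm by (simp add: rational_field_def m)
  qed (use l m in auto)
  have W_Z: "JW $$ (n, l) = (if l = n then \<phi> * of_nat r else 0)" if l: "l < Suc n" for l
  proof (rule JW_entry)
    have "((\<lambda>t. of_nat r * (P(l := t)) n * F j (P(l := t))) has_field_derivative
        (if l = n then \<phi> * of_nat r else 0)) (at (P l))"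
      using l j m Pm
      by (intro DERIV_cong[OF DERIV_mult[OF DERIV_cmult[OF DERIV_upd] DERIV_F]])
        (auto simp: FP \<phi>_def)
    then show "((\<lambda>t. ?W (P(l := t)) n) has_field_derivative (if l = n then \<phi> * of_nat r else 0)) (at (P l))"
      using l[folded m] Pm by (simp add: polynomial_field_def n_eq h_upd)
  qed (use l m in auto)

  have V_\<epsilon>: "JV $$ (Suc n, l) = (if l = Suc n then of_nat (r + 1) else 0)" if l: "l < Suc (Suc n)" for l
  proof (rule JV_entry)
    have "((\<lambda>t. of_nat (r + 1) * (P(l := t)) m) has_field_derivative
        (if l = Suc n then of_nat (r + 1) else 0)) (at (P l))"
      by (rule DERIV_cong[OF DERIV_cmult[OF DERIV_upd]]) (auto simp: m)
    then show "((\<lambda>t. ?V (P(l := t)) (Suc n)) has_field_derivative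
        (if l = Suc n then of_nat (r + 1) else 0)) (at (P l))"
      by (simp add: rational_field_def m)
  qed (use l m in auto)
  have W_\<epsilon>: "JW $$ (Suc n, l) = 0" if l: "l < Suc n" for l
  proof (rule JW_entry)
    show "((\<lambda>t. ?W (P(l := t)) (Suc n)) has_field_derivative 0) (at (P l))"
      using l Pm m by (simp add: polynomial_field_def)
  qed (use l m in auto)
  have W_\<epsilon>\<epsilon>: "JW $$ (Suc n, Suc n) = \<phi> * of_nat (r + 1)"
  proof (rule JW_entry)
    obtain G' where G': "((\<lambda>t. chart_remainder m p r g j j (P(m := t))) has_field_derivative G') (at 0)"
      using DERIV_G by blast
    \<comment> \<open>The slice puts entry \<open>m\<close> of a chart point into position
      \<open>m + 1\<close>, beyond those that \<open>f j\<close> reads.\<close>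
    have "F j (P(m := t)) = \<phi>" for t
      unfolding F_def \<phi>_def Q_def chart_slice_upd using j(1)
      by (intro polynomial_in_cong[OF f_poly]) (auto simp: insert_index_def)
    then have h_eps: "?h j (P(m := t)) = \<phi> + t * chart_remainder m p r g j j (P(m := t))" for t
      by (simp add: chart_rhs_def F_def)
    \<comment> \<open>The remainder carries the factor \<open>t * t\<close>, so with
      \<open>G'\<close> finite it contributes nothing at \<open>t = 0\<close>.\<close>
    have "((\<lambda>t. of_nat (r + 1) * t * (\<phi> + t * chart_remainder m p r g j j (P(m := t))))
        has_field_derivative \<phi> * of_nat (r + 1)) (at 0)"
      by (auto intro!: derivative_eq_intros G')
    then show "((\<lambda>t. ?W (P(Suc n := t)) (Suc n)) has_field_derivative \<phi> * of_nat (r + 1)) (at (P (Suc n)))"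
      unfolding m[symmetric] by (simp add: polynomial_field_def n_eq n_m Pm(1) h_eps)
  qed (use m in auto)

  \<comment> \<open>Comparison of the spectra\<close>
  have J_carrier: "JV \<in> carrier_mat (Suc (Suc n)) (Suc (Suc n))" "JW \<in> carrier_mat (Suc (Suc n)) (Suc (Suc n))"
    by (auto simp: JV_def JW_def jacobi_matrix_def m)
  have "Matrix.mat n n (\<lambda>(k, l). JV $$ (k, l)) = M"
    using M by (intro eq_matI) (auto simp: V_block)
  then have eig_V: "eigenvalue_mset JV = {#of_nat r, of_nat (r + 1)#} + eigenvalue_mset M"
    by (subst eigenvalue_mset_two_last_rows[OF J_carrier(1)]) (auto simp: V_Z V_\<epsilon>)
  have "Matrix.mat n n (\<lambda>(k, l). JW $$ (k, l)) = \<phi> \<cdot>\<^sub>m M"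
    using M by (intro eq_matI) (auto simp: W_block)
  then have "eigenvalue_mset JW = {#\<phi> * of_nat r, \<phi> * of_nat (r + 1)#} + eigenvalue_mset (\<phi> \<cdot>\<^sub>m M)"
    by (subst eigenvalue_mset_two_last_rows[OF J_carrier(2)]) (auto simp: W_Z W_\<epsilon> W_\<epsilon>\<epsilon>)
  \<comment> \<open>The \<open>X\<close>-block and both remaining diagonal entries scale by
    \<open>\<phi>\<close>, which is the witness for \<open>\<kappa>\<close>.\<close>
  then have eig_W: "eigenvalue_mset JW = image_mset (\<lambda>\<mu>. \<phi> * \<mu>) (eigenvalue_mset JV)"
    by (simp add: eigenvalue_mset_smult[OF M \<phi>0] eig_V)
  have "?h j P \<noteq> 0"
    using \<phi>0 by (simp add: hP \<phi>_def)
  then show ?thesis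
    using V0 W0 eig_V eig_W \<phi>0 unfolding P_def[symmetric] JV_def[symmetric] JW_def[symmetric] K_M
    by auto
qed

end
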